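(* The point $x_1\in\mathbb C\setminus\widehat W$ cannot be a deep point of $\mathbb C\setminus\widehat W$. This means that there exists a constant $K$ with $0<K<1$ such that for all radii $r\in\mathbb R_+$, $r>0$, there exists a ball of radius $Kr$ inside the intersection $\widehat W\cap B(x_1,r)$.
   Context: Let $\ell\geq 2$ be an even integer. Let $f$ be the real analytic function which near $0$ coincides with the real fixed point of period-doubling renormalization with critical point of degree $\ell$. With $\lambda=-f(f(0))\in(0,1)$, it satisfies the Cvitanović–Feigenbaum equation: $f(z)=-\frac1\lambda f(f(\lambda z))$ near $0$; $f(0)=1$; and $f(z)=F(z^\ell)$, where $F^{-1}$ is defined and univalent on $\mathbb C_\lambda=\mathbb C\setminus(]-\infty,-1/\lambda]\cup[1/\lambda^2,+\infty[)$. An analytic extension of $f$ is a holomorphic function on a connected open subset of $\mathbb C$ which agrees with $f$ on some nonempty open set. It is known that $f$ has a unique maximal analytic extension $\hat f:\widehat W\to\mathbb C$, i.e. one of which all analytic extensions are restrictions, and that $\widehat W$ is a simply connected, dense open subset of $\mathbb C$. Let $\mathbb H_\pm$ be the upper/lower half-planes, $\mathcal W=F^{-1}(\mathbb C_\lambda)$, $W=\{z: z^\ell\in\mathcal W\}$, $W_+=W\cap\{z:0<\operatorname{Arg}(z)<\pi/\ell\}$. It is known (Epstein) that $F^{-1}(z)$ tends to a point of $\mathbb H_+$, denoted $F^{-1}(-i\infty)$, as $z\to\infty$ in $\mathbb H_-$. The point $x_1$ is the point of the boundary $\partial W_+$ with $(x_1)^\ell=F^{-1}(-i\infty)$. $B(x,r)$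 is the open Euclidean disk of center $x$ and radius $r$.
   Formalization: The constant K may depend on an upper bound R for the radii (for every R > 0 one K in (0,1) serves all 0 < r ≤ R), because a single K for all r > 0 fails as r tends to infinity: the sets λ^n Ŵ decrease to a set with empty interior. *)

theory Defs
  imports "HOL-Complex_Analysis.Complex_Analysis"
begin

definition slit_plane :: "real \<Rightarrow> complex set" where
  "slit_plane lam = - (complex_of_real ` ({.. -1/lam} \<union> {1/lam^2 ..}))"

text \<open>
  The function \<open>f\<close> is given on some domain \<open>U\<close> around \<open>[-1,1]\<close>: the inner \<open>f\<close> in the
  Cvitanovic-Feigenbaum equation is evaluated near \<open>f 0 = 1\<close>, so a germ at \<open>0\<close> alone
  would not be enough. The condition \<open>lam < f lam\<close> says that \<open>[-lam,lam]\<close> and its image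
  \<open>[f lam, 1]\<close> are disjoint, i.e. that the unimodal map is renormalizable with period two.
  The degree of the critical point is fixed by \<open>inverse_univalent\<close> below.
\<close>
definition period_doubling_fixed_point ::
  "real \<Rightarrow> complex set \<Rightarrow> (complex \<Rightarrow> complex) \<Rightarrow> bool" where
  "period_doubling_fixed_point lam U f \<longleftrightarrow>
     0 < lam \<and> lam < 1 \<and>
     open U \<and> connected U \<and> complex_of_real ` {-1..1} \<subseteq> U \<and> f holomorphic_on U \<and>
     f ` complex_of_real ` {-1..1} \<subseteq> complex_of_real ` {-1..1} \<and>
     (\<forall>x y. 0 \<le> x \<longrightarrow> x < y \<longrightarrow> y \<le> 1 \<longrightarrow> Re (f (of_real y)) < Re (f (of_real x))) \<and>
     lam < Re (f (of_real lam)) \<and>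
     f 0 = 1 \<and> complex_of_real lam = - f (f 0) \<and>
     (\<forall>\<^sub>F z in nhds 0. f z = - (1 / of_real lam) * f (f (of_real lam * z)))"

text \<open>
  \<open>G\<close> is the univalent map \<open>F\<^sup>-\<^sup>1\<close>, so that \<open>F\<close> itself is \<open>the_inv_into (slit_plane lam) G\<close>,
  with domain \<open>G ` slit_plane lam\<close>. As \<open>F\<close> is univalent near \<open>0\<close>, the last condition gives
  \<open>f\<close> a critical point of degree exactly \<open>l\<close> at \<open>0\<close>.
\<close>
definition inverse_univalent ::
  "nat \<Rightarrow> real \<Rightarrow> (complex \<Rightarrow> complex) \<Rightarrow> (complex \<Rightarrow> complex) \<Rightarrow> bool" where
  "inverse_univalent l lam f G \<longleftrightarrow>
     G holomorphic_on slit_plane lam \<and> inj_on G (slit_plane lam) \<and>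
     (\<forall>\<^sub>F z in nhds 0. z ^ l \<in> G ` slit_plane lam \<and>
                      f z = the_inv_into (slit_plane lam) G (z ^ l))"

definition analytic_extension ::
  "complex set \<Rightarrow> (complex \<Rightarrow> complex) \<Rightarrow> complex set \<Rightarrow> (complex \<Rightarrow> complex) \<Rightarrow> bool" where
  "analytic_extension U f V g \<longleftrightarrow>
     open V \<and> connected V \<and> g holomorphic_on V \<and>
     (\<exists>S. open S \<and> S \<noteq> {} \<and> S \<subseteq> U \<inter> V \<and> (\<forall>z\<in>S. g z = f z))"

definition maximal_analytic_extension ::
  "complex set \<Rightarrow> (complex \<Rightarrow> complex) \<Rightarrow> complex set \<Rightarrow> (complex \<Rightarrow> complex) \<Rightarrow> bool" where
  "maximal_analytic_extension U f V g \<longleftrightarrow>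
     analytic_extension U f V g \<and>
     (\<forall>V' g'. analytic_extension U f V' g' \<longrightarrow> V' \<subseteq> V \<and> (\<forall>z\<in>V'. g' z = g z))"

definition W_dom :: "nat \<Rightarrow> real \<Rightarrow> (complex \<Rightarrow> complex) \<Rightarrow> complex set" where
  "W_dom l lam G = {z. z ^ l \<in> G ` slit_plane lam}"

definition W_plus :: "nat \<Rightarrow> real \<Rightarrow> (complex \<Rightarrow> complex) \<Rightarrow> complex set" where
  "W_plus l lam G = W_dom l lam G \<inter> {z. 0 < Arg z \<and> Arg z < pi / real l}"

text \<open>
  The set \<open>A\<close> has relatively large complement at \<open>x\<close>: on every bounded range \<open>]0,R]\<close> of
  radii, a disk of radius \<open>K * r\<close> fits in the complement of \<open>A\<close> inside the disk of radius
  \<open>r\<close> about \<open>x\<close>. The constant may depend on \<open>R\<close>: depth is a property of \<open>A\<close> at small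
  scales. Asking for one \<open>K\<close> up to \<open>r = \<infinity>\<close> would be a condition on \<open>A\<close> at infinity, and
  it fails for the complement of the domain of the Feigenbaum function: if \<open>D\<close> is that
  domain, the sets \<open>lam^n D\<close> decrease to a set with empty interior.
\<close>
definition not_deep_at :: "complex set \<Rightarrow> complex \<Rightarrow> bool" where
  "not_deep_at A x \<longleftrightarrow>
     (\<forall>R>0. \<exists>K. 0 < K \<and> K < 1 \<and>
        (\<forall>r. 0 < r \<and> r \<le> R \<longrightarrow> (\<exists>y. ball y (K * r) \<subseteq> (- A) \<inter> ball x r)))"

end

theory Submission
  imports Defs
begin

text \<open>
  Let \<open>\<Phi> = G\<^bsup>1/l\<^esup>\<close>, with the principal root. The Cvitanovic-Feigenbaum equation reads
  \<open>\<Phi>(\<Phi>(- \<lambda> \<zeta>)) = \<lambda> \<Phi>(\<zeta>)\<close> off the real axis, so that \<open>B(z) = \<lambda>\<^bsup>-1\<^esup> \<Phi>(\<lambda>\<^bsup>-1\<^esup> \<Phi>(z))\<close> satisfies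
  \<open>B(\<Phi>(\<zeta>)) = \<Phi>(\<zeta> / \<lambda>\<^sup>2)\<close> on the lower half-plane. Letting \<open>\<zeta>\<close> tend to infinity shows that
  \<open>x\<^sub>1 = \<Phi>(-i\<infinity>)\<close> is a fixed point of \<open>B\<close>. As \<open>B\<close> maps the upper half-plane injectively into
  the first quadrant, the Schwarz lemma gives \<open>0 < \<bar>B'(x\<^sub>1)\<bar> < 1\<close>. The open set \<open>E\<close> of all
  \<open>\<Phi>(\<zeta>)\<close>, \<open>\<zeta>\<close> in the lower half-plane, is mapped into itself by \<open>B\<close>, accumulates at \<open>x\<^sub>1\<close>, and lies in
  the maximal domain because \<open>\<Phi>\<^bsup>-1\<^esup>\<close> continues \<open>f\<close> to it. Since \<open>B\<close> is nearly linear at \<open>x\<^sub>1\<close>, its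
  iterates carry one disk in \<open>E\<close> to disks in \<open>E\<close> of proportional size at all small scales.
\<close>

subsection \<open>Invariant open sets at an attracting fixed point\<close>

text \<open>Monotonicity lets the disks be sought in any convenient open subset of the complement of
  \<open>A'\<close>.\<close>

lemma not_deep_at_mono:
  assumes "not_deep_at A x" and "A' \<subseteq> A"
  shows "not_deep_at A' x"
  using assms unfolding not_deep_at_def by (meson Compl_anti_mono Int_mono dual_order.trans subset_refl)

text \<open>On \<open>ball x r\<close> the derivative stays within \<open>C * r\<close> of
  \<open>\<mu>\<close>, so \<open>B\<close> stretches distances there by factors between
  \<open>norm \<mu> - C * r\<close> and \<open>norm \<mu> + C * r\<close>. The lower factor also
  makes \<open>B\<close> injective, hence open.\<close>

lemma near_linear_ball_image:
  fixes B :: "complex \<Rightarrow> complex"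
  assumes hol: "B holomorphic_on ball x s" and fixed: "B x = x"
    and lip: "\<And>z. z \<in> ball x s \<Longrightarrow> norm (deriv B z - \<mu>) \<le> C * norm (z - x)"
    and C: "0 \<le> C" "C * r < norm \<mu>" and r: "0 < r" "r \<le> s"
    and sub: "ball y t \<subseteq> ball x r"
  shows "ball (B y) ((norm \<mu> - C * r) * t) \<subseteq> B ` ball y t"
    and "B ` ball y t \<subseteq> ball x ((norm \<mu> + C * r) * r)"
proof -
  \<comment> \<open>Mean value inequality for \<open>B z - \<mu> * z\<close>, whose derivative has
    norm at most \<open>C * r\<close>.\<close>
  have near: "norm ((B z - \<mu> * z) - (B w - \<mu> * w)) \<le> C * r * norm (z - w)"
    if "z \<in> ball x r" "w \<in> ball x r" for z w
  proof (rule field_differentiable_bound[OF convex_ball, where f' = "\<lambda>z. deriv B z - \<mu>"])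
    fix v assume v: "v \<in> ball x r"
    then have vs: "v \<in> ball x s" using r by auto
    then have "(B has_field_derivative deriv B v) (at v)"
      using hol holomorphic_derivI open_ball by blast
    then show "((\<lambda>z. B z - \<mu> * z) has_field_derivative deriv B v - \<mu>) (at v within ball x r)"
      by (auto intro!: derivative_eq_intros intro: DERIV_subset)
    have "norm (v - x) \<le> r" using v by (simp add: dist_norm norm_minus_commute)
    then show "norm (deriv B v - \<mu>) \<le> C * r"
      using lip[OF vs] C(1) by (meson mult_left_mono order_trans)
  qed (use that in auto)
  have split: "B z - B w = ((B z - \<mu> * z) - (B w - \<mu> * w)) + \<mu> * (z - w)" for z w
    by (simp add: algebra_simps)
  have up: "norm (B z - B w) \<le> (norm \<mu> + C * r) * norm (z - w)"
    if "z \<in> ball x r" "w \<in> ball x r" for z w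
    using near[OF that] norm_triangle_ineq[of "(B z - \<mu> * z) - (B w - \<mu> * w)" "\<mu> * (z - w)"]
    unfolding split[of z w] norm_mult by (simp add: algebra_simps)
  have low: "(norm \<mu> - C * r) * norm (z - w) \<le> norm (B z - B w)"
    if "z \<in> ball x r" "w \<in> ball x r" for z w
    using near[OF that] norm_diff_ineq[of "\<mu> * (z - w)" "(B z - \<mu> * z) - (B w - \<mu> * w)"]
    unfolding split[of z w] norm_mult by (simp add: algebra_simps)
  have inj: "inj_on B (ball x r)"
  proof (rule inj_onI)
    fix z w assume "z \<in> ball x r" "w \<in> ball x r" "B z = B w"
    with low[of z w] C(2) have "norm (z - w) \<le> 0"
      by (simp add: mult_le_0_iff)
    then show "z = w" by simp
  qed
  have x: "x \<in> ball x r" using r by simp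
  show "B ` ball y t \<subseteq> ball x ((norm \<mu> + C * r) * r)"
  proof safe
    fix z assume "z \<in> ball y t"
    then have z: "z \<in> ball x r" using sub by blast
    have "norm (B z - x) \<le> (norm \<mu> + C * r) * norm (z - x)"
      using up[OF z x] fixed by simp
    also have "\<dots> < (norm \<mu> + C * r) * r"
    proof (rule mult_strict_left_mono)
      show "norm (z - x) < r" using z by (simp add: dist_norm norm_minus_commute)
      have "0 \<le> C * r" using C r by simp
      then show "0 < norm \<mu> + C * r" using C by linarith
    qed
    finally show "B z \<in> ball x ((norm \<mu> + C * r) * r)"
      by (simp add: dist_norm norm_minus_commute)
  qed
  show "ball (B y) ((norm \<mu> - C * r) * t) \<subseteq> B ` ball y t"
  proof
    fix p assume p: "p \<in> ball (B y) ((norm \<mu> - C * r) * t)"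
    define a where "a = norm \<mu> - C * r"
    have a: "0 < a" using C by (simp add: a_def)
    have "dist (B y) p < a * t" using p by (simp add: a_def)
    then have "dist (B y) p / a < t" using a by (simp add: field_simps)
    \<comment> \<open>The covering argument needs control of \<open>B\<close> on the bounding
      circle, which \<open>ball y t\<close> may not offer; a slightly smaller closed disk, depending
      on \<open>p\<close>, does.\<close>
    then obtain t' where t': "dist (B y) p / a < t'" "t' < t" using dense by blast
    moreover have "0 \<le> dist (B y) p / a" using a by simp
    ultimately have t'0: "0 < t'" by linarith
    have csub: "cball y t' \<subseteq> ball x r" using t' sub by force
    have hol': "B holomorphic_on cball y t'"
      using csub r hol by (meson holomorphic_on_subset order_trans subset_ball)
    have "ball (B y) (a * t') \<subseteq> B ` cball y t'"
    proof (rule ball_subset_open_map_image)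
      show "continuous_on (closure (cball y t')) B"
        using hol' holomorphic_on_imp_continuous_on by auto
      show "open (B ` interior (cball y t'))"
        using inj_on_subset[OF inj, of "ball y t'"] holomorphic_on_subset[OF hol', of "ball y t'"]
          order_trans[OF ball_subset_cball csub] by (auto intro!: open_mapping_thm3)
      show "a * t' \<le> norm (B z - B y)" if "z \<in> frontier (cball y t')" for z
      proof -
        have z: "z \<in> cball y t'" "norm (z - y) = t'"
          using that t'0 by (auto simp: dist_norm norm_minus_commute)
        moreover have "y \<in> cball y t'" using t'0 by simp
        ultimately show ?thesis using low[of z y] csub by (auto simp only: a_def)
      qed
    qed (use t'0 a in auto)
    moreover have "p \<in> ball (B y) (a * t')" using t' a by (simp add: field_simps)
    ultimately show "p \<in> B ` ball y t" using t' by force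
  qed
qed

text \<open>Differentiability of \<open>deriv B\<close> at \<open>x\<close> with tolerance 1 yields
  the constant \<open>norm D + 1\<close>, where \<open>D\<close> is the second derivative.\<close>

lemma holomorphic_deriv_locally_lipschitz:
  fixes B :: "complex \<Rightarrow> complex"
  assumes "B holomorphic_on T" "open T" "x \<in> T"
  obtains s C where "0 < s" "0 < C" "ball x s \<subseteq> T"
    "\<And>z. z \<in> ball x s \<Longrightarrow> norm (deriv B z - deriv B x) \<le> C * norm (z - x)"
proof -
  define D where "D = deriv (deriv B) x"
  have "(deriv B has_field_derivative D) (at x)"
    unfolding D_def using assms holomorphic_deriv holomorphic_derivI by blast
  then have "(deriv B has_derivative (*) D) (at x)"
    by (simp add: has_field_derivative_def)
  then obtain d where d: "0 < d" "\<And>z. norm (z - x) < d \<Longrightarrow>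
      norm (deriv B z - deriv B x - D * (z - x)) \<le> 1 * norm (z - x)"
    unfolding has_derivative_at_alt by (metis zero_less_one)
  obtain e where e: "0 < e" "ball x e \<subseteq> T" using assms openE by blast
  show thesis
  proof (rule that[of "min d e" "norm D + 1"])
    fix z assume "z \<in> ball x (min d e)"
    then have "norm (z - x) < d" by (simp add: dist_norm norm_minus_commute)
    from d(2)[OF this]
    show "norm (deriv B z - deriv B x) \<le> (norm D + 1) * norm (z - x)"
      using norm_triangle_ineq[of "deriv B z - deriv B x - D * (z - x)" "D * (z - x)"]
      unfolding diff_add_cancel norm_mult by (simp add: algebra_simps)
  qed (use d e in \<open>auto simp: add_nonneg_pos\<close>)
qed

text \<open>One disk of \<open>E\<close> near \<open>x\<close> is pushed forward by
  \<open>B\<close>. At each step the ratio of its radius to that of the enclosing disk about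
  \<open>x\<close> loses a factor \<open>(m - C * \<rho> n) / (m + C * \<rho> n)\<close>; as
  \<open>\<rho> n\<close> decays geometrically, the product of these factors stays away from
  0.\<close>

lemma attracting_fixed_point_not_deep:
  fixes B :: "complex \<Rightarrow> complex"
  assumes hol: "B holomorphic_on T" "open T" "x \<in> T" and fixed: "B x = x"
    and \<mu>: "deriv B x \<noteq> 0" "norm (deriv B x) < 1"
    and E: "open E" "x \<in> closure E" "B ` (E \<inter> T) \<subseteq> E"
  shows "not_deep_at (- E) x"
proof -
  obtain s C where s: "0 < s" "0 < C" "ball x s \<subseteq> T"
    and lip: "\<And>z. z \<in> ball x s \<Longrightarrow> norm (deriv B z - deriv B x) \<le> C * norm (z - x)"
    using holomorphic_deriv_locally_lipschitz[OF hol] by metis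
  define m where "m = norm (deriv B x)"
  define q where "q = (1 + m) / 2"
  have m: "0 < m" "m < 1" using \<mu> by (auto simp: m_def)
  have q: "m < q" "q < 1" "0 < q" using m by (auto simp: q_def)
  \<comment> \<open>The three bounds ensure in turn that the Lipschitz estimate applies, that
    \<open>m + C * r0 \<le> q\<close> (so the radii decay at least like \<open>q ^ n\<close>), and
    that the distortion at step \<open>n\<close> is paid for by the decrease of
    \<open>(1 + q ^ n) / 2\<close>.\<close>
  define r0 where "r0 = Min {s, (q - m) / C, m * (1 - q) / (4 * C)}"
  have "0 < r0" "r0 \<le> s" "r0 \<le> (q - m) / C" "r0 \<le> m * (1 - q) / (4 * C)"
    using s m q by (auto simp: r0_def)
  then have r0: "0 < r0" "r0 \<le> s" "C * r0 \<le> q - m" "4 * C * r0 \<le> m * (1 - q)"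
    using s by (simp_all add: pos_le_divide_eq mult_ac)
  \<comment> \<open>The recursion is exactly the outer radius bound of
    \<open>near_linear_ball_image\<close>.\<close>
  define \<rho> where "\<rho> = rec_nat r0 (\<lambda>_ r. (m + C * r) * r)"
  have \<rho>_simps: "\<rho> 0 = r0" "\<rho> (Suc n) = (m + C * \<rho> n) * \<rho> n" for n
    by (simp_all add: \<rho>_def)
  have \<rho>: "0 < \<rho> n \<and> \<rho> n \<le> r0 * q ^ n" for n
  proof (induction n)
    case 0 then show ?case using r0 by (simp add: \<rho>_simps)
  next
    case (Suc n)
    have "r0 * q ^ n \<le> r0" using r0 q by (simp add: mult_left_le power_le_one)
    then have "C * \<rho> n \<le> q - m" using Suc s r0 by (smt (verit) mult_left_mono)
    then have "(m + C * \<rho> n) * \<rho> n \<le> q * (r0 * q ^ n)"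
      using Suc q by (intro mult_mono) auto
    moreover have "0 < (m + C * \<rho> n) * \<rho> n" using Suc m s by (simp add: add_pos_pos)
    ultimately show ?case by (simp add: \<rho>_simps mult_ac)
  qed
  have \<rho>_le: "\<rho> n \<le> r0" for n
    using \<rho>[of n] r0 q by (smt (verit) mult_left_le power_le_one)
  obtain y0 where "y0 \<in> E" "dist y0 x < r0" using E r0 closure_approachable by metis
  then have "open (E \<inter> ball x r0)" "y0 \<in> E \<inter> ball x r0" using E by (auto simp: dist_commute)
  then obtain t0 where t0: "0 < t0" "ball y0 t0 \<subseteq> E \<inter> ball x r0" using openE by blast
  define \<kappa> where "\<kappa> = min (t0 / r0) 1"
  have \<kappa>: "0 < \<kappa>" "\<kappa> \<le> 1" "\<kappa> * r0 \<le> t0" using t0 r0 by (auto simp: \<kappa>_def min_def field_simps)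
  \<comment> \<open>The distortion of \<open>B\<close> at scale \<open>\<rho> n\<close> is \<open>O(\<rho> n)\<close>; the sum of these errors is finite,
    which the factor \<open>(1 + q ^ n) / 2\<close> keeps track of.\<close>
  have step: "\<exists>y. ball y (\<kappa> * ((1 + q ^ n) / 2) * \<rho> n) \<subseteq> E \<inter> ball x (\<rho> n)" for n
  proof (induction n)
    case 0
    have "ball y0 (\<kappa> * r0) \<subseteq> ball y0 t0" using \<kappa> by (simp add: subset_ball)
    then show ?case using t0 by (auto simp: \<rho>_simps)
  next
    case (Suc n)
    define t where "t = \<kappa> * ((1 + q ^ n) / 2) * \<rho> n"
    from Suc obtain y where y: "ball y t \<subseteq> E \<inter> ball x (\<rho> n)" by (auto simp: t_def)
    have qn: "0 < q ^ n" "q ^ n \<le> 1" using q by (auto simp: power_le_one)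
    have "4 * C * \<rho> n \<le> 4 * C * (r0 * q ^ n)" using \<rho>[of n] s by (simp add: mult_left_mono)
    also have "\<dots> \<le> m * (1 - q) * q ^ n"
      using mult_right_mono[OF r0(4), of "q ^ n"] qn by (simp add: mult_ac)
    finally have small: "4 * C * \<rho> n \<le> m * (1 - q) * q ^ n" .
    have "m * (1 - q) * q ^ n < m * 1" 
      using m q qn by (smt (verit) mult_less_cancel_left_pos mult_left_le mult_pos_pos)
    moreover have "0 < C * \<rho> n" using s \<rho>[of n] by simp
    ultimately have Cm: "C * \<rho> n < m" using small by linarith
    have "ball (B y) ((m - C * \<rho> n) * t) \<subseteq> B ` ball y t"
      and "B ` ball y t \<subseteq> ball x ((m + C * \<rho> n) * \<rho> n)"
      using near_linear_ball_image[of B x s "deriv B x" C "\<rho> n" y t] 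
        holomorphic_on_subset[OF hol(1) s(3)] fixed lip s Cm \<rho>[of n] \<rho>_le[of n] r0 y
      by (auto simp: m_def)
    moreover have "B ` ball y t \<subseteq> E"
      using y E(3) s(3) \<rho>_le[of n] r0(2) by (force simp: subset_iff)
    moreover have "\<kappa> * ((1 + q ^ Suc n) / 2) * \<rho> (Suc n) \<le> (m - C * \<rho> n) * t"
    proof -
      \<comment> \<open>After expansion this is \<open>C * \<rho> n * (2 + q ^ n + q ^ Suc n) \<le>
        m * (q ^ n - q ^ Suc n)\<close>, where the bracket on the left is at most 4.\<close>
      have "(1 + q ^ Suc n) * (m + C * \<rho> n) \<le> (1 + q ^ n) * (m - C * \<rho> n)"
      proof -
        have "C * \<rho> n * (2 + q ^ n + q ^ Suc n) \<le> C * \<rho> n * 4"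
          using qn q s \<rho>[of n] mult_le_one[of q "q ^ n"] by (intro mult_left_mono) auto
        also have "\<dots> \<le> m * (q ^ n - q ^ Suc n)" using small by (simp add: algebra_simps)
        finally show ?thesis by (simp add: algebra_simps)
      qed
      then have "\<kappa> / 2 * \<rho> n * ((1 + q ^ Suc n) * (m + C * \<rho> n))
          \<le> \<kappa> / 2 * \<rho> n * ((1 + q ^ n) * (m - C * \<rho> n))"
        using \<kappa> \<rho>[of n] by (intro mult_left_mono) auto
      then show ?thesis by (simp add: t_def \<rho>_simps mult_ac)
    qed
    ultimately have "ball (B y) (\<kappa> * ((1 + q ^ Suc n) / 2) * \<rho> (Suc n)) \<subseteq> E \<inter> ball x (\<rho> (Suc n))"
      unfolding \<rho>_simps by (meson subset_ball order_trans le_inf_iff)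
    then show ?case by blast
  qed
  have "(\<lambda>n. r0 * q ^ n) \<longlonglongrightarrow> r0 * 0"
    using q by (intro tendsto_intros LIMSEQ_realpow_zero) auto
  then have lim: "\<rho> \<longlonglongrightarrow> 0"
    using \<rho> by (intro tendsto_sandwich[of "\<lambda>_. 0" \<rho> _ "\<lambda>n. r0 * q ^ n" 0])
      (auto intro: always_eventually less_imp_le)
  show ?thesis unfolding not_deep_at_def
  proof (intro allI impI)
    fix R :: real assume R: "R > 0"
    \<comment> \<open>The factor 1/2 bounds \<open>(1 + q ^ n) / 2\<close> from below. The factor
      \<open>m\<close> covers radii between consecutive \<open>\<rho>\<close>, since
      \<open>\<rho> (Suc k) \<ge> m * \<rho> k\<close>; the factor \<open>r0 / R\<close> covers
      radii from \<open>r0\<close> to \<open>R\<close>.\<close>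
    define K where "K = \<kappa> / 2 * min m (r0 / R)"
    have K: "0 < K" "K \<le> \<kappa> / 2 * m" "K \<le> \<kappa> / 2 * (r0 / R)"
      unfolding K_def using \<kappa> m r0 R by (auto intro!: mult_left_mono mult_pos_pos simp del: times_divide_eq_left times_divide_eq_right)
    have "\<kappa> / 2 * m \<le> 1 / 2 * m" using \<kappa> m by (intro mult_right_mono) auto
    then have "K < 1" using K m by linarith
    moreover have "\<exists>y. ball y (K * r) \<subseteq> - (- E) \<inter> ball x r" if r: "0 < r \<and> r \<le> R" for r
    proof -
      have "\<exists>n. \<rho> n \<le> r"
        using order_tendstoD(2)[OF lim, of r] r
        by (metis (mono_tags, lifting) eventually_sequentially less_imp_le order_refl)
      then obtain N where N: "\<rho> N \<le> r" "\<And>k. k < N \<Longrightarrow> \<not> \<rho> k \<le> r"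
        using exists_least_iff[of "\<lambda>n. \<rho> n \<le> r"] by blast
      have "K * r \<le> \<kappa> / 2 * \<rho> N"
      proof (cases N)
        case 0
        have "K * r \<le> \<kappa> / 2 * (r0 / R) * R" using K r \<kappa> r0 R by (intro mult_mono) auto
        then show ?thesis using R 0 by (simp add: \<rho>_simps)
      next
        case (Suc k)
        then have k: "r < \<rho> k" using N(2) by fastforce
        have "K * r \<le> \<kappa> / 2 * m * \<rho> k" using K r \<kappa> m k by (intro mult_mono) auto
        also have "\<dots> \<le> \<kappa> / 2 * \<rho> N"
          using \<kappa> \<rho>[of k] s by (simp add: Suc \<rho>_simps algebra_simps)
        finally show ?thesis .
      qed
      also have "\<dots> \<le> \<kappa> * ((1 + q ^ N) / 2) * \<rho> N"
        using \<kappa> \<rho>[of N] q by (intro mult_right_mono) auto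
      finally have le: "K * r \<le> \<kappa> * ((1 + q ^ N) / 2) * \<rho> N" .
      obtain y where "ball y (\<kappa> * ((1 + q ^ N) / 2) * \<rho> N) \<subseteq> E \<inter> ball x (\<rho> N)"
        using step by blast
      then have "ball y (K * r) \<subseteq> E \<inter> ball x r"
        using subset_ball[OF le, of y] subset_ball[OF N(1), of x] by blast
      then show ?thesis by auto
    qed
    ultimately show "\<exists>K. 0 < K \<and> K < 1 \<and>
        (\<forall>r. 0 < r \<and> r \<le> R \<longrightarrow> (\<exists>y. ball y (K * r) \<subseteq> - (- E) \<inter> ball x r))"
      using K by blast
  qed
qed

subsection \<open>The Schwarz lemma in the upper half-plane and principal roots\<close>

text \<open>The Cayley map \<open>\<phi>\<close>, with inverse \<open>\<psi>\<close>, sends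
  \<open>a\<close> to 0 and turns \<open>B\<close> into a self-map \<open>h\<close> of the disk
  fixing 0 with the same derivative. Equality in the Schwarz lemma would make \<open>h\<close> a
  rotation, hence \<open>B\<close> surjective.\<close>

lemma upper_half_plane_Schwarz_Pick_strict:
  fixes B :: "complex \<Rightarrow> complex"
  assumes hol: "B holomorphic_on {z. Im z > 0}"
    and into: "B ` {z. Im z > 0} \<subset> {z. Im z > 0}"
    and a: "Im a > 0" "B a = a"
  shows "norm (deriv B a) < 1"
proof -
  define \<phi> where "\<phi> z = (z - a) / (z - cnj a)" for z
  define \<psi> where "\<psi> w = (a - w * cnj a) / (1 - w)" for w
  have ne: "z - cnj a \<noteq> 0" if "Im z > 0" for z
    using that a by (auto simp: complex_eq_iff)
  have aa: "a - cnj a \<noteq> 0" using ne a by blast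
  have norm_\<phi>: "norm (\<phi> z) < 1" if "Im z > 0" for z
  proof -
    have "(norm (z - a))\<^sup>2 < (norm (z - cnj a))\<^sup>2"
      using that a mult_pos_pos[of "Im z" "Im a"]
      unfolding cmod_power2 by (simp add: power2_eq_square algebra_simps)
    then have "norm (z - a) < norm (z - cnj a)"
      using norm_ge_zero power2_less_imp_less by blast
    then show ?thesis using ne[OF that] by (simp add: \<phi>_def norm_divide)
  qed
  have ne1: "1 - w \<noteq> 0" if "norm w < 1" for w :: complex using that by auto
  have \<phi>\<psi>: "\<phi> (\<psi> w) = w" if "norm w < 1" for w
  proof -
    have "\<psi> w - a = w * (a - cnj a) / (1 - w)" "\<psi> w - cnj a = (a - cnj a) / (1 - w)"
      using ne1[OF that] by (auto simp: \<psi>_def field_simps)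
    then show ?thesis using ne1[OF that] aa by (simp add: \<phi>_def)
  qed
  have \<psi>\<phi>: "\<psi> (\<phi> z) = z" if "Im z > 0" for z
  proof -
    have "a - \<phi> z * cnj a = z * (a - cnj a) / (z - cnj a)" "1 - \<phi> z = (a - cnj a) / (z - cnj a)"
      using ne[OF that] by (auto simp: \<phi>_def field_simps)
    then show ?thesis using ne[OF that] aa by (simp add: \<psi>_def)
  qed
  have Im_\<psi>: "Im (\<psi> w) > 0" if "norm w < 1" for w
  proof -
    have "(norm w)\<^sup>2 < 1" using that by (simp add: abs_square_less_1)
    \<comment> \<open>In the product with \<open>cnj (1 - w)\<close> the cross terms
      \<open>a * cnj w\<close> and \<open>w * cnj a\<close> are conjugate, so their sum is
      real.\<close>
    then have "0 < Im a * (1 - (norm w)\<^sup>2)" using a by simp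
    also have "\<dots> = Im ((a - w * cnj a) * cnj (1 - w))"
      unfolding cmod_power2 by (simp add: power2_eq_square algebra_simps)
    also have "\<dots> = Im (\<psi> w) * (norm (1 - w))\<^sup>2"
    proof -
      have "(a - w * cnj a) * cnj (1 - w) = \<psi> w * of_real ((norm (1 - w))\<^sup>2)"
        using ne1[OF that] unfolding complex_norm_square by (simp add: \<psi>_def)
      then show ?thesis by (simp only: times_complex.sel Re_complex_of_real Im_complex_of_real)
    qed
    finally show ?thesis by (simp add: zero_less_mult_iff)
  qed
  define h where "h = (\<lambda>w. \<phi> (B (\<psi> w)))"
  have BIm: "Im (B z) > 0" if "Im z > 0" for z using into that by blast
  have hol\<psi>: "\<psi> holomorphic_on ball 0 1"
    unfolding \<psi>_def using ne1 by (intro holomorphic_intros) auto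
  have hol\<phi>: "\<phi> holomorphic_on {z. Im z > 0}"
    unfolding \<phi>_def using ne by (intro holomorphic_intros) auto
  have holB\<psi>: "(\<lambda>w. B (\<psi> w)) holomorphic_on ball 0 1"
    using holomorphic_on_compose_gen[OF hol\<psi> hol] Im_\<psi> by (auto simp: o_def image_subset_iff)
  have holh: "h holomorphic_on ball 0 1"
    using holomorphic_on_compose_gen[OF holB\<psi> hol\<phi>] BIm Im_\<psi> by (auto simp: o_def h_def image_subset_iff)
  have \<psi>0: "\<psi> 0 = a" by (simp add: \<psi>_def)
  have h0: "h 0 = 0" using a by (simp add: h_def \<psi>0 \<phi>_def)
  have hn: "norm (h w) < 1" if "norm w < 1" for w
    unfolding h_def using norm_\<phi> BIm Im_\<psi> that by blast
  have dh: "deriv h 0 = deriv B a"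
  proof -
    have d\<psi>: "(\<psi> has_field_derivative (a - cnj a)) (at 0)"
      unfolding \<psi>_def by (auto intro!: derivative_eq_intros)
    have d\<phi>: "(\<phi> has_field_derivative 1 / (a - cnj a)) (at a)"
      unfolding \<phi>_def using aa by (auto intro!: derivative_eq_intros)
    have "(B has_field_derivative deriv B a) (at a)"
      using hol a open_halfspace_Im_gt[of 0] by (intro holomorphic_derivI[of B "{z. Im z > 0}"]) auto
    then have "((\<lambda>w. B (\<psi> w)) has_field_derivative deriv B a * (a - cnj a)) (at 0)"
      using DERIV_chain2[OF _ d\<psi>] \<psi>0 by auto
    then have "(h has_field_derivative 1 / (a - cnj a) * (deriv B a * (a - cnj a))) (at 0)"
      unfolding h_def using d\<phi> \<psi>0 a(2) by (intro DERIV_chain2[of \<phi> _ "\<lambda>w. B (\<psi> w)"]) simp_all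
    then show ?thesis using aa by (simp add: DERIV_imp_deriv)
  qed
  have "norm (deriv h 0) \<le> 1" using Schwarz_Lemma(2)[OF holh h0 hn] by (metis norm_zero zero_less_one)
  moreover have "norm (deriv h 0) \<noteq> 1"
  proof
    assume "norm (deriv h 0) = 1"
    then obtain \<alpha> where \<alpha>: "\<And>z. norm z < 1 \<Longrightarrow> h z = \<alpha> * z" "norm \<alpha> = 1"
      using Schwarz_Lemma(3)[OF holh h0 hn] by (metis norm_zero zero_less_one)
    have "{z. Im z > 0} \<subseteq> B ` {z. Im z > 0}"
    proof
      fix z assume "z \<in> {z. Im z > 0}"
      then have z: "Im z > 0" by simp
      define w where "w = \<phi> z / \<alpha>"
      have w: "norm w < 1" using norm_\<phi>[OF z] \<alpha> by (simp add: w_def norm_divide)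
      have "\<phi> (B (\<psi> w)) = \<phi> z" using \<alpha>(1)[OF w] \<alpha>(2) by (auto simp: h_def w_def)
      then have "B (\<psi> w) = z" using \<psi>\<phi> BIm Im_\<psi>[OF w] z by metis
      then show "z \<in> B ` {z. Im z > 0}" using Im_\<psi>[OF w] by blast
    qed
    then show False using into by blast
  qed
  ultimately show ?thesis using dh by simp
qed

section \<open>Principal roots of degree \<open>l\<close>\<close>

definition proot :: "nat \<Rightarrow> complex \<Rightarrow> complex" where
  "proot l w = exp (Ln w / of_nat l)"

lemma proot_power: "l > 0 \<Longrightarrow> w \<noteq> 0 \<Longrightarrow> proot l w ^ l = w"
  by (simp add: proot_def exp_of_nat_mult[symmetric])

lemma proot_eqI:
  assumes "l > 0" "z \<noteq> 0" "- pi < of_nat l * Arg z" "of_nat l * Arg z \<le> pi"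
  shows "proot l (z ^ l) = z"
proof -
  have "z ^ l = exp (of_nat l * Ln z)" using assms by (simp add: exp_of_nat_mult)
  then have "Ln (z ^ l) = of_nat l * Ln z"
    using assms Ln_exp[of "of_nat l * Ln z"] by (simp add: Arg_def)
  then show ?thesis using assms by (simp add: proot_def)
qed

text \<open>The argument, in ]0,pi[, is divided by at least 2 and so lands in ]0,pi/2[.\<close>

lemma proot_upper:
  assumes "l \<ge> 2" "Im w > 0"
  shows "0 < Re (proot l w)" "0 < Im (proot l w)"
proof -
  have 1: "0 < Im (Ln w)" "Im (Ln w) < pi" using Im_Ln_pos_lt_imp assms by auto
  have "Im (Ln w) / of_nat l \<le> Im (Ln w) / 2" using assms 1 by (intro divide_left_mono) auto
  then have "Im (Ln w) / of_nat l < pi / 2" using 1 by linarith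
  moreover have "0 < Im (Ln w) / of_nat l" using 1 assms by simp
  moreover have "Im (Ln w) / of_nat l < pi" using calculation pi_gt_zero by linarith
  ultimately show "0 < Re (proot l w)" "0 < Im (proot l w)"
    by (auto simp: proot_def Re_exp Im_exp intro!: mult_pos_pos cos_gt_zero_pi sin_gt_zero)
qed

lemma proot_cnj: "Im w \<noteq> 0 \<Longrightarrow> proot l (cnj w) = cnj (proot l w)"
  by (simp add: proot_def exp_cnj cnj_Ln complex_nonpos_Reals_iff)

lemma proot_lower:
  assumes "l \<ge> 2" "Im w < 0"
  shows "Im (proot l w) < 0"
  using proot_upper(2)[of l "cnj w"] proot_cnj[of w l] assms by simp

lemma proot_mult_power:
  assumes "l > 0" "0 < a" "w \<noteq> 0"
  shows "proot l (of_real a ^ l * w) = of_real a * proot l w"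
proof -
  have "Ln (of_real (a ^ l) * w) = of_real (ln (a ^ l)) + Ln w"
    using assms Ln_times_of_real[of "a ^ l" w] Ln_of_real[of "a ^ l"] by simp
  then have "Ln (of_real a ^ l * w) = of_nat l * of_real (ln a) + Ln w"
    using assms by (simp add: ln_realpow)
  then show ?thesis
    using assms by (simp add: proot_def add_divide_distrib exp_add exp_of_real)
qed

lemma holomorphic_on_proot [holomorphic_intros]:
  assumes "g holomorphic_on S" "\<And>z. z \<in> S \<Longrightarrow> g z \<notin> \<real>\<^sub>\<le>\<^sub>0"
  shows "(\<lambda>z. proot l (g z)) holomorphic_on S"
  unfolding proot_def divide_inverse
  using assms by (intro holomorphic_intros) auto

section \<open>Topology of the slit plane\<close>

text \<open>Two half-planes bridged by a vertical strip: three open convex sets, from which openness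
  and connectedness are read off.\<close>

lemma slit_plane_eq:
  "slit_plane lam = {z. Im z > 0} \<union> {z. Im z < 0} \<union> {z. - 1 / lam < Re z \<and> Re z < 1 / lam\<^sup>2}"
proof -
  have "z \<in> complex_of_real ` A \<longleftrightarrow> Im z = 0 \<and> Re z \<in> A" for z A
    by (auto simp: image_iff complex_eq_iff)
  then show ?thesis unfolding slit_plane_def by force
qed

lemma mem_slit_plane: "z \<in> slit_plane lam \<longleftrightarrow> Im z \<noteq> 0 \<or> (- 1 / lam < Re z \<and> Re z < 1 / lam\<^sup>2)"
  unfolding slit_plane_eq by auto

lemma of_real_in_slit_plane:
  assumes "0 < lam" "lam < 1" "x \<in> {-1..1}"
  shows "complex_of_real x \<in> slit_plane lam"
proof -
  have "lam\<^sup>2 < 1" using assms by (simp add: abs_square_less_1)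
  then have "1 < 1 / lam" "1 < 1 / lam\<^sup>2" using assms by auto
  then have "- 1 / lam < x" "x < 1 / lam\<^sup>2" using assms(3) by auto
  then show ?thesis by (simp add: mem_slit_plane)
qed

lemma open_slit_plane: "open (slit_plane lam)"
  unfolding slit_plane_eq
  by (intro open_Un open_halfspace_Im_gt open_halfspace_Im_lt open_Collect_conj
      open_halfspace_Re_gt open_halfspace_Re_lt)

lemma connected_slit_plane:
  assumes "0 < lam"
  shows "connected (slit_plane lam)"
proof -
  let ?S = "{z. - 1 / lam < Re z \<and> Re z < 1 / lam\<^sup>2}"
  have "convex ?S"
    using convex_Int[OF convex_halfspace_Re_gt convex_halfspace_Re_lt] by (simp add: Collect_conj_eq)
  then have conn: "connected ?S" "connected {z. Im z > 0}" "connected {z. Im z < 0}"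
    by (simp_all add: convex_connected convex_halfspace_Im_gt convex_halfspace_Im_lt)
  have i: "\<i> \<in> {z. Im z > 0} \<inter> ?S" "-\<i> \<in> {z. Im z < 0} \<inter> ?S" using assms by auto
  have conn': "connected ({z. Im z > 0} \<union> ?S)" "connected ({z. Im z < 0} \<union> ?S)"
    using connected_Un[OF conn(2,1)] connected_Un[OF conn(3,1)] i by blast+
  then have "connected (({z. Im z > 0} \<union> ?S) \<union> ({z. Im z < 0} \<union> ?S))"
    using connected_Un[OF conn'] i by blast
  moreover have "slit_plane lam = ({z. Im z > 0} \<union> ?S) \<union> ({z. Im z < 0} \<union> ?S)"
    unfolding slit_plane_eq by blast
  ultimately show ?thesis by simp
qed

subsection \<open>The functional equation of the inverse map\<close>

text \<open>The point \<open>c\<close> is the value of \<open>G\<close> at -i infinity, approached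
  without restriction inside the open lower half-plane.\<close>

locale feigenbaum =
  fixes l :: nat and lam :: real and U :: "complex set" and f G :: "complex \<Rightarrow> complex" and c :: complex
  assumes l: "l \<ge> 2"
    and pd: "period_doubling_fixed_point lam U f"
    and inv_uni: "inverse_univalent l lam f G"
    and lim: "(G \<longlongrightarrow> c) (inf at_infinity (principal {z. Im z < 0}))"
    and Im_c: "Im c > 0"
begin

lemma lam: "0 < lam" "lam < 1"
  using pd by (auto simp: period_doubling_fixed_point_def)

lemma f_U: "open U" "complex_of_real ` {-1..1} \<subseteq> U" "f holomorphic_on U" "f 0 = 1" "f 1 = - of_real lam"
  using pd by (auto simp: period_doubling_fixed_point_def)

lemma f_real:
  assumes "x \<in> {-1..1}"
  obtains y where "y \<in> {-1..1}" "f (of_real x) = of_real y"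
proof -
  have "f ` complex_of_real ` {-1..1} \<subseteq> complex_of_real ` {-1..1}"
    using pd by (auto simp: period_doubling_fixed_point_def)
  then show thesis using assms that by blast
qed

lemma f_decreasing: "0 \<le> x \<Longrightarrow> x < y \<Longrightarrow> y \<le> 1 \<Longrightarrow> Re (f (of_real y)) < Re (f (of_real x))"
  using pd by (auto simp: period_doubling_fixed_point_def)

lemma G_holo: "G holomorphic_on slit_plane lam" and G_inj: "inj_on G (slit_plane lam)"
  using inv_uni by (auto simp: inverse_univalent_def)

lemma isCont_f_0: "isCont f 0"
proof -
  have "0 \<in> U" using f_U(2) by (force simp: image_iff)
  then show ?thesis using f_U(1,3) by (meson continuous_on_eq_continuous_at holomorphic_on_imp_continuous_on)
qed

text \<open>The identity holds near 0 because \<open>f\<close> is there the inverse of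
  \<open>G\<close> applied to \<open>z ^ l\<close>. The identity theorem carries it over the
  component of 0 in the part of \<open>U\<close> that \<open>f\<close> maps into the slit plane;
  this component contains [-1,1], which \<open>f\<close> maps into itself.\<close>

lemma G_f:
  obtains S where "open S" "S \<subseteq> U" "complex_of_real ` {-1..1} \<subseteq> S"
    "\<And>z. z \<in> S \<Longrightarrow> f z \<in> slit_plane lam" "\<And>z. z \<in> S \<Longrightarrow> G (f z) = z ^ l"
proof -
  define S0 where "S0 = U \<inter> f -` slit_plane lam"
  define S where "S = connected_component_set S0 0"
  have "open S0" unfolding S0_def
    using f_U open_slit_plane by (meson continuous_open_preimage holomorphic_on_imp_continuous_on)
  then have S: "open S" "connected S" "S \<subseteq> S0"
    by (auto simp: S_def open_connected_component connected_component_subset)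
  have sub0: "complex_of_real ` {-1..1} \<subseteq> S0"
  proof safe
    fix x :: real assume x: "x \<in> {-1..1}"
    then obtain y where "y \<in> {-1..1}" "f (of_real x) = of_real y" by (rule f_real)
    then show "of_real x \<in> S0" using x f_U(2) lam of_real_in_slit_plane by (auto simp: S0_def)
  qed
  have "connected (complex_of_real ` {-1..1})"
    by (intro connected_continuous_image continuous_intros) auto
  then have sub: "complex_of_real ` {-1..1} \<subseteq> S"
    unfolding S_def using sub0 by (intro connected_component_maximal) (auto simp: image_iff intro: bexI[of _ 0])
  have fS: "f z \<in> slit_plane lam" if "z \<in> S" for z using S(3) that by (auto simp: S0_def)
  have "\<forall>\<^sub>F z in nhds 0. z ^ l \<in> G ` slit_plane lam \<and>
      f z = the_inv_into (slit_plane lam) G (z ^ l)"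
    using inv_uni by (auto simp: inverse_univalent_def)
  then obtain N where N: "open N" "0 \<in> N" "\<And>z. z \<in> N \<Longrightarrow> G (f z) = z ^ l"
    unfolding eventually_nhds using G_inj by (metis f_the_inv_into_f)
  have holf: "f holomorphic_on S" using S(3) f_U(3) by (auto simp: S0_def intro: holomorphic_on_subset)
  have "G (f z) = z ^ l" if "z \<in> S" for z
  proof (rule analytic_continuation_open[where s = "S \<inter> N" and s' = S and f = "\<lambda>z. G (f z)" and g = "\<lambda>z. z ^ l"])
    show "(\<lambda>z. G (f z)) holomorphic_on S"
      using holomorphic_on_compose_gen[OF holf G_holo] fS by (auto simp: o_def image_subset_iff)
    show "S \<inter> N \<noteq> {}" using subsetD[OF sub, of "of_real 0"] N(2) by auto
  qed (use S N that in \<open>auto intro!: holomorphic_intros\<close>)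
  then show thesis using that S sub fS by (auto simp: S0_def)
qed

lemma G_f_real:
  assumes "x \<in> {-1..1}"
  shows "G (f (of_real x)) = of_real x ^ l"
proof -
  obtain S where "complex_of_real ` {-1..1} \<subseteq> S" "\<And>z. z \<in> S \<Longrightarrow> G (f z) = z ^ l"
    using G_f by metis
  then show ?thesis using assms by blast
qed

text \<open>Strict monotonicity keeps these values off \<open>f 0 = 1\<close>, while continuity
  brings them arbitrarily near. They serve as the accumulating set in the identity theorem.\<close>

lemma one_islimpt:
  assumes "0 < e" "e \<le> 1"
  shows "1 islimpt (\<lambda>x. f (of_real x)) ` {0<..<e}"
  unfolding islimpt_approachable
proof (intro allI impI)
  fix d :: real assume "0 < d"
  then obtain \<delta> where \<delta>: "0 < \<delta>" "\<And>z. norm z < \<delta> \<Longrightarrow> dist (f z) 1 < d"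
    using isCont_f_0 f_U(4) unfolding continuous_at_eps_delta by (auto simp: dist_norm)
  define x where "x = min (e / 2) (\<delta> / 2)"
  have x: "0 < x" "x < e" "x < \<delta>" using \<delta> assms by (auto simp: x_def)
  have "f (of_real x) \<noteq> 1" using f_decreasing[of 0 x] x assms f_U(4) by auto
  moreover have "dist (f (of_real x)) 1 < d" using \<delta>(2) x by simp
  ultimately show "\<exists>y\<in>(\<lambda>x. f (of_real x)) ` {0<..<e}. y \<noteq> 1 \<and> dist y 1 < d"
    using x by auto
qed

text \<open>\<open>G\<close> and its conjugate by \<open>cnj\<close> agree at the real points
  \<open>f x\<close>, where \<open>G\<close> takes the real value \<open>x ^ l\<close>; such points
  accumulate at 1.\<close>

lemma G_cnj:
  assumes "z \<in> slit_plane lam"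
  shows "G (cnj z) = cnj (G z)"
proof -
  have cnj_slit: "cnj ` slit_plane lam = slit_plane lam"
    by (auto simp: mem_slit_plane image_iff intro!: bexI[where x = "cnj _"])
  have "(cnj \<circ> G \<circ> cnj) holomorphic_on slit_plane lam"
    using G_holo cnj_slit by (intro holomorphic_on_compose_cnj_cnj open_slit_plane) auto
  then have hol: "(\<lambda>z. (cnj \<circ> G \<circ> cnj) z - G z) holomorphic_on slit_plane lam"
    by (intro holomorphic_intros G_holo)
  have "(cnj \<circ> G \<circ> cnj) z - G z = 0"
  proof (rule analytic_continuation[OF hol])
    show "(1::complex) \<in> slit_plane lam" using of_real_in_slit_plane[of lam 1] lam by simp
    show "1 islimpt (\<lambda>x. f (of_real x)) ` {0<..<1}" by (rule one_islimpt) auto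
    show "(\<lambda>x. f (of_real x)) ` {0<..<1} \<subseteq> slit_plane lam"
    proof safe
      fix x :: real assume "x \<in> {0<..<1}"
      then obtain y where "y \<in> {-1..1}" "f (of_real x) = of_real y" using f_real[of x] by auto
      then show "f (of_real x) \<in> slit_plane lam" using lam of_real_in_slit_plane by auto
    qed
    fix p assume "p \<in> (\<lambda>x. f (of_real x)) ` {0<..<1}"
    then obtain x where x: "0 < x" "x < 1" "p = f (of_real x)" by auto
    then obtain y where "p = of_real y" using f_real[of x] by auto
    moreover have "G p = of_real x ^ l" using x G_f_real[of x] by auto
    ultimately show "(cnj \<circ> G \<circ> cnj) p - G p = 0" by simp
  qed (use assms open_slit_plane connected_slit_plane lam in auto)
  then show ?thesis by (metis comp_apply complex_cnj_cnj eq_iff_diff_eq_0)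
qed

lemma G_seq:
  assumes "filterlim a at_infinity sequentially" "\<And>n. Im (a n) < 0"
  shows "(\<lambda>n. G (a n)) \<longlonglongrightarrow> c"
  using assms by (intro filterlim_compose[OF lim]) (auto simp: filterlim_inf filterlim_principal)

lemma lower_seq:
  obtains a where "filterlim a at_infinity sequentially" "\<And>n. Im (a n) < 0"
proof
  have "filterlim (\<lambda>n. norm (- \<i> * of_nat (Suc n))) at_top sequentially"
    by (simp add: norm_mult del: of_nat_Suc) (rule filterlim_compose[OF filterlim_real_sequentially filterlim_Suc])
  then show "filterlim (\<lambda>n. - \<i> * of_nat (Suc n)) at_infinity sequentially"
    by (rule filterlim_norm_at_top_imp_at_infinity)
qed auto

text \<open>Near infinity the values of \<open>G\<close> are close to \<open>c\<close>, hence in the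
  upper half-plane. A value elsewhere would, by connectedness, force a real value
  \<open>G w\<close>; then \<open>G (cnj w) = G w\<close>, against injectivity.\<close>

lemma G_lower:
  assumes "Im z < 0"
  shows "Im (G z) > 0"
proof (rule ccontr)
  assume neg: "\<not> Im (G z) > 0"
  obtain a where a: "filterlim a at_infinity sequentially" "\<And>n. Im (a n) < 0" using lower_seq by metis
  have "(\<lambda>n. Im (G (a n))) \<longlonglongrightarrow> Im c" using G_seq[OF a] by (rule tendsto_Im)
  then have "\<forall>\<^sub>F n in sequentially. 0 < Im (G (a n))" using Im_c by (rule order_tendstoD(1))
  then obtain n where n: "0 < Im (G (a n))" using eventually_happens'[OF sequentially_bot] by blast
  have sub: "{z. Im z < 0} \<subseteq> slit_plane lam" by (auto simp: mem_slit_plane)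
  have "connected (G ` {z. Im z < 0})"
    using sub by (intro connected_continuous_image convex_connected[OF convex_halfspace_Im_lt]
        holomorphic_on_imp_continuous_on[OF holomorphic_on_subset[OF G_holo]])
  then have "\<exists>w\<in>G ` {z. Im z < 0}. w \<bullet> \<i> = 0"
    using connected_ivt_component[of _ "G z" "G (a n)" \<i> 0] assms neg n a(2)[of n]
    by (auto simp: inner_complex_def)
  then obtain w where w: "Im w < 0" "Im (G w) = 0" by (auto simp: inner_complex_def)
  have "G (cnj w) = G w" using G_cnj[of w] w by (simp add: complex_eq_iff mem_slit_plane)
  then have "cnj w = w" using G_inj w by (auto simp: inj_on_def mem_slit_plane)
  then show False using w by (simp add: complex_eq_iff)
qed

lemma G_upper: "Im z > 0 \<Longrightarrow> Im (G z) < 0"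
  using G_lower[of "cnj z"] G_cnj[of z] by (simp add: mem_slit_plane)

lemma G_proot_nonreal:
  assumes "Im z \<noteq> 0"
  shows "Im (proot l (G z)) \<noteq> 0"
  using assms G_lower[of z] G_upper[of z] proot_upper(2)[OF l] proot_lower[OF l]
  by (metis less_irrefl linorder_less_linear)

text \<open>At \<open>p = f x\<close>, with \<open>x > 0\<close> small, the Cvitanovic-Feigenbaum
  equation says \<open>- lam * p = f (f (lam * x))\<close>. Applying \<open>G\<close>, the root and
  \<open>G\<close> again gives \<open>(lam * x) ^ l\<close>, which is \<open>lam ^ l * G p\<close>.
  The identity theorem extends this from points near 1 to all nonreal points.\<close>

lemma G_functional_equation:
  assumes "Im z \<noteq> 0"
  shows "G (proot l (G (- of_real lam * z))) = of_real lam ^ l * G z"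
proof -
  define k where "k = (\<lambda>z. G (- of_real lam * z))"
  define r where "r = (\<lambda>z. proot l (k z))"
  \<comment> \<open>\<open>D1\<close>, \<open>D2\<close>, \<open>D3\<close> are the successive
    domains on which the argument of the root, the root, and the full composition are
    holomorphic.\<close>
  define D1 where "D1 = slit_plane lam \<inter> (\<lambda>z. - of_real lam * z) -` slit_plane lam"
  define D2 where "D2 = D1 \<inter> k -` (- \<real>\<^sub>\<le>\<^sub>0)"
  define D3 where "D3 = D2 \<inter> r -` slit_plane lam"
  have D1: "open D1" unfolding D1_def
    by (intro continuous_open_preimage open_slit_plane continuous_intros)
  have hol_k: "k holomorphic_on D1"
    unfolding k_def using holomorphic_on_compose_gen[OF _ G_holo, of "\<lambda>z. - of_real lam * z" D1]
    by (auto simp: o_def D1_def intro!: holomorphic_intros)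
  then have D2: "open D2" unfolding D2_def
    by (intro continuous_open_preimage D1 holomorphic_on_imp_continuous_on) (auto simp: closed_nonpos_Reals_complex open_Compl)
  have hol_r: "r holomorphic_on D2"
    unfolding r_def by (intro holomorphic_intros holomorphic_on_subset[OF hol_k]) (auto simp: D2_def)
  then have D3: "open D3" unfolding D3_def
    by (intro continuous_open_preimage D2 holomorphic_on_imp_continuous_on open_slit_plane)
  have hol: "(\<lambda>z. G (r z) - of_real lam ^ l * G z) holomorphic_on D3"
    using holomorphic_on_compose_gen[OF holomorphic_on_subset[OF hol_r] G_holo, of D3]
    by (auto simp: o_def D3_def D2_def D1_def intro!: holomorphic_intros holomorphic_on_subset[OF G_holo])
  have nonreal: "z \<in> D3" if "Im z \<noteq> 0" for z
  proof -
    have "Im (- of_real lam * z) \<noteq> 0" using that lam by simp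
    moreover from this have "Im (k z) \<noteq> 0"
      unfolding k_def by (metis G_lower G_upper less_irrefl linorder_less_linear)
    moreover have "Im (r z) \<noteq> 0"
      unfolding r_def k_def by (rule G_proot_nonreal) fact
    ultimately show ?thesis
      using that by (auto simp: D3_def D2_def D1_def mem_slit_plane complex_nonpos_Reals_iff)
  qed
  \<comment> \<open>Since \<open>f 1 = - lam\<close>, the whole chain fixes 1, so 1 is an interior
    point of \<open>D3\<close>.\<close>
  have k1: "k 1 = 1" using G_f_real[of 1] f_U(5) by (simp add: k_def)
  have r1: "r 1 = 1" using proot_eqI[of l 1] l by (simp add: r_def k1)
  have "- of_real lam \<in> slit_plane lam" "1 \<in> slit_plane lam"
    using of_real_in_slit_plane[of lam 1] of_real_in_slit_plane[of lam "- lam"] lam by auto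
  then have "1 \<in> D3" by (auto simp: D3_def D2_def D1_def k1 r1)
  then obtain e where e: "0 < e" "ball 1 e \<subseteq> D3" using D3 openE by blast
  \<comment> \<open>The disk at 1 joins the two half-planes into one connected domain.\<close>
  define T where "T = {z. Im z > 0} \<union> ball 1 e \<union> {z. Im z < 0}"
  have T: "open T" "T \<subseteq> D3" "z \<in> T" "1 \<in> T"
    using e nonreal assms open_halfspace_Im_gt[of 0] open_halfspace_Im_lt[of 0] by (auto simp: T_def)
  have "1 + \<i> * of_real (e / 2) \<in> {z. Im z > 0} \<inter> ball 1 e" "1 - \<i> * of_real (e / 2) \<in> ball 1 e \<inter> {z. Im z < 0}"
    using e by (auto simp: dist_norm norm_mult)
  then have "connected T" unfolding T_def
    by (intro connected_Un convex_connected convex_halfspace_Im_gt convex_halfspace_Im_lt convex_ball) blast+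
  have "\<forall>\<^sub>F z in nhds 0. f z = - (1 / of_real lam) * f (f (of_real lam * z))"
    using pd by (auto simp: period_doubling_fixed_point_def)
  then obtain \<delta>1 where \<delta>1: "0 < \<delta>1"
    "\<And>z. norm z < \<delta>1 \<Longrightarrow> f z = - (1 / of_real lam) * f (f (of_real lam * z))"
    by (auto simp: eventually_nhds_metric)
  \<comment> \<open>The bound \<open>e\<close> keeps \<open>f x\<close> inside \<open>T\<close>; the
    bound 1 makes \<open>f (lam * x)\<close> positive, so that the principal root of its power
    returns it.\<close>
  obtain \<delta>2 where \<delta>2: "0 < \<delta>2" "\<And>z. norm z < \<delta>2 \<Longrightarrow> dist (f z) 1 < min e 1"
    using isCont_f_0 f_U(4) e(1) unfolding continuous_at_eps_delta
    by (metis diff_zero dist_norm min_less_iff_conj zero_less_one)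
  define d where "d = min 1 (min \<delta>1 \<delta>2)"
  have d: "0 < d" "d \<le> 1" "d \<le> \<delta>1" "d \<le> \<delta>2" using \<delta>1 \<delta>2 by (auto simp: d_def)
  have "G (r z) - of_real lam ^ l * G z = 0"
  proof (rule analytic_continuation[OF holomorphic_on_subset[OF hol T(2)] T(1) \<open>connected T\<close> _ T(4)
        one_islimpt[OF d(1,2)] _ T(3)])
    show "(\<lambda>x. f (complex_of_real x)) ` {0<..<d} \<subseteq> T"
      using \<delta>2(2) d by (force simp: T_def dist_commute)
    fix p assume "p \<in> (\<lambda>x. f (complex_of_real x)) ` {0<..<d}"
    then obtain x where x: "0 < x" "x < d" "p = f (of_real x)" by auto
    have lx: "0 < lam * x" "lam * x < d" using x lam by (auto intro: order_le_less_trans[of _ "1 * x"])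
    then obtain y where y: "y \<in> {-1..1}" "f (of_real (lam * x)) = of_real y"
      using f_real[of "lam * x"] d by auto
    have "dist (complex_of_real y) 1 < 1"
      using \<delta>2(2)[of "of_real (lam * x)"] lx d y by (auto simp del: of_real_mult)
    then have "dist y 1 < 1" by (metis dist_of_real of_real_1)
    then have y0: "0 < y" by (simp add: dist_real_def)
    have "p = - (1 / of_real lam) * f (of_real y)"
      using \<delta>1(2)[of "of_real x"] x d y by simp
    then have "- of_real lam * p = f (of_real y)" using lam by simp
    then have "k p = of_real y ^ l" using G_f_real[OF y(1)] by (simp add: k_def)
    then have "r p = of_real y" using proot_eqI[of l "of_real y"] l y0 by (simp add: r_def)
    then have "G (r p) = of_real (lam * x) ^ l" using G_f_real[of "lam * x"] lx d y by simp
    moreover have "G p = of_real x ^ l" using G_f_real[of x] x d by simp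
    ultimately show "G (r p) - of_real lam ^ l * G p = 0" by (simp add: power_mult_distrib)
  qed
  then show ?thesis by (simp add: r_def k_def)
qed

subsection \<open>The contraction fixing the boundary point\<close>

text \<open>In view of \<open>Phi_functional_equation\<close>, \<open>B\<close> is the second iterate of the inverse branch
  \<open>z \<mapsto> Phi (cnj z) / lam\<close> of \<open>z \<mapsto> cnj (f (lam * z))\<close>, written without conjugation.\<close>

definition Phi :: "complex \<Rightarrow> complex" where "Phi \<zeta> = proot l (G \<zeta>)"

definition E :: "complex set" where "E = Phi ` {\<zeta>. Im \<zeta> < 0}"

definition B :: "complex \<Rightarrow> complex" where "B z = Phi (Phi z / of_real lam) / of_real lam"

definition x0 :: complex where "x0 = proot l c"

lemma nonreal_in_slit_plane: "Im z \<noteq> 0 \<Longrightarrow> z \<in> slit_plane lam"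
  by (simp add: mem_slit_plane)

lemma G_nonreal: "Im z \<noteq> 0 \<Longrightarrow> Im (G z) \<noteq> 0"
  by (metis G_lower G_upper less_irrefl linorder_less_linear)

lemma Phi_power: "Im z \<noteq> 0 \<Longrightarrow> Phi z ^ l = G z"
  unfolding Phi_def using G_nonreal[of z] l by (intro proot_power) auto

lemma Phi_lower: "Im z < 0 \<Longrightarrow> 0 < Re (Phi z) \<and> 0 < Im (Phi z)"
  unfolding Phi_def using proot_upper[OF l] G_lower by blast

lemma Phi_upper: "Im z > 0 \<Longrightarrow> Im (Phi z) < 0"
  unfolding Phi_def using proot_lower[OF l] G_upper by blast

lemma Phi_inj: "inj_on Phi {z. Im z \<noteq> 0}"
proof (rule inj_onI)
  fix z w assume "z \<in> {z. Im z \<noteq> 0}" "w \<in> {z. Im z \<noteq> 0}" and eq: "Phi z = Phi w"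
  then have zw: "Im z \<noteq> 0" "Im w \<noteq> 0" by auto
  then have "G z = G w" using eq Phi_power by metis
  then show "z = w" using G_inj zw nonreal_in_slit_plane by (auto dest: inj_onD)
qed

lemma Phi_holo: "Phi holomorphic_on {z. Im z \<noteq> 0}"
  unfolding Phi_def
  using G_nonreal nonreal_in_slit_plane
  by (intro holomorphic_intros holomorphic_on_subset[OF G_holo]) (auto simp: complex_nonpos_Reals_iff)

lemma Phi_functional_equation:
  assumes "Im z \<noteq> 0"
  shows "Phi (Phi (- of_real lam * z)) = of_real lam * Phi z"
proof -
  have "G z \<noteq> 0" using G_nonreal[OF assms] by auto
  then show ?thesis
    using G_functional_equation[OF assms] proot_mult_power[of l lam "G z"] l lam by (simp add: Phi_def)
qed

text \<open>The functional equation at \<open>- \<zeta> / lam\<close> and then at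
  \<open>\<zeta> / lam ^ 2\<close> evaluates the inner and the outer \<open>Phi\<close>.\<close>

lemma B_Phi:
  assumes "Im \<zeta> < 0"
  shows "B (Phi \<zeta>) = Phi (\<zeta> / of_real lam ^ 2)"
proof -
  have "Im (- \<zeta> / of_real lam) \<noteq> 0" "Im (\<zeta> / of_real lam ^ 2) \<noteq> 0"
    using assms lam by (simp_all flip: of_real_power)
  from this[THEN Phi_functional_equation]
  show ?thesis using lam by (simp add: B_def power2_eq_square)
qed

lemma B_quadrant:
  assumes "Im z > 0"
  shows "0 < Re (B z)" "0 < Im (B z)"
proof -
  have "Im (Phi z / of_real lam) < 0" using Phi_upper[OF assms] lam by (simp add: divide_neg_pos)
  then show "0 < Re (B z)" "0 < Im (B z)" using Phi_lower lam by (auto simp: B_def)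
qed

lemma B_holo: "B holomorphic_on {z. Im z > 0}"
proof -
  have 1: "(\<lambda>z. Phi z / of_real lam) holomorphic_on {z. Im z > 0}"
    using lam by (intro holomorphic_intros holomorphic_on_subset[OF Phi_holo]) auto
  have "(\<lambda>z. Phi z / of_real lam) ` {z. Im z > 0} \<subseteq> {z. Im z \<noteq> 0}"
    using Phi_upper lam by fastforce
  from holomorphic_on_compose_gen[OF 1 Phi_holo this] show ?thesis
    unfolding B_def using lam by (intro holomorphic_intros) (auto simp: o_def)
qed

lemma B_inj: "inj_on B {z. Im z > 0}"
proof (rule inj_onI)
  fix z w assume "z \<in> {z. Im z > 0}" "w \<in> {z. Im z > 0}" and eq: "B z = B w"
  then have zw: "Im z > 0" "Im w > 0" by auto
  have "Phi (Phi z / of_real lam) = Phi (Phi w / of_real lam)"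
    using eq lam by (simp add: B_def)
  moreover have "Im (Phi z / of_real lam) \<noteq> 0" "Im (Phi w / of_real lam) \<noteq> 0"
    using Phi_upper[OF zw(1)] Phi_upper[OF zw(2)] lam by auto
  ultimately have "Phi z / of_real lam = Phi w / of_real lam"
    using Phi_inj by (auto dest!: inj_onD)
  then have "Phi z = Phi w" using lam by simp
  then show "z = w" using Phi_inj zw by (auto dest!: inj_onD)
qed

lemma x0_quadrant: "0 < Re x0" "0 < Im x0"
  using proot_upper[OF l Im_c] by (auto simp: x0_def)

lemma Phi_seq:
  assumes "filterlim a at_infinity sequentially" "\<And>n. Im (a n) < 0"
  shows "(\<lambda>n. Phi (a n)) \<longlonglongrightarrow> x0"
proof -
  have "isCont (proot l) c"
    unfolding proot_def using Im_c l by (intro continuous_intros) (auto simp: complex_nonpos_Reals_iff)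
  then show ?thesis unfolding Phi_def x0_def by (rule isCont_tendsto_compose[OF _ G_seq[OF assms]])
qed

text \<open>Division by \<open>lam ^ 2\<close> preserves both the lower half-plane and divergence to
  infinity, so both sides of \<open>B_Phi\<close> can be followed along one sequence.\<close>

lemma B_fixed: "B x0 = x0"
proof -
  obtain a where a: "filterlim a at_infinity sequentially" "\<And>n. Im (a n) < 0" using lower_seq by metis
  have "isCont B x0"
    using B_holo x0_quadrant open_halfspace_Im_gt[of 0] continuous_on_eq_continuous_at
      holomorphic_on_imp_continuous_on by blast
  then have 1: "(\<lambda>n. B (Phi (a n))) \<longlonglongrightarrow> B x0"
    by (rule isCont_tendsto_compose[OF _ Phi_seq[OF a]])
  have "filterlim (\<lambda>n. a n * inverse (of_real lam ^ 2)) at_infinity sequentially"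
    using lam by (intro tendsto_mult_filterlim_at_infinity[OF tendsto_const _ a(1), of "inverse (of_real lam ^ 2)", simplified mult.commute]) auto
  then have "filterlim (\<lambda>n. a n / of_real lam ^ 2) at_infinity sequentially"
    by (simp add: divide_inverse)
  moreover have "Im (a n / of_real lam ^ 2) < 0" for n
    using a(2)[of n] lam by (simp add: divide_neg_pos flip: of_real_power)
  ultimately have "(\<lambda>n. Phi (a n / of_real lam ^ 2)) \<longlonglongrightarrow> x0" by (rule Phi_seq)
  then have "(\<lambda>n. B (Phi (a n))) \<longlonglongrightarrow> x0" using a(2) by (simp add: B_Phi)
  with 1 show ?thesis by (rule LIMSEQ_unique)
qed

lemma B_multiplier: "deriv B x0 \<noteq> 0" "norm (deriv B x0) < 1"
proof -
  show "deriv B x0 \<noteq> 0"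
    using holomorphic_injective_imp_regular[OF B_holo open_halfspace_Im_gt B_inj] x0_quadrant by simp
  \<comment> \<open>Any point of the open second quadrant shows that \<open>B\<close> is not onto
    the upper half-plane.\<close>
  have "B z \<noteq> \<i> - 1" if "Im z > 0" for z using B_quadrant(1)[OF that] by auto
  then have "\<i> - 1 \<notin> B ` {z. Im z > 0}" by force
  moreover have "\<i> - 1 \<in> {z. Im z > 0}" by simp
  ultimately have "B ` {z. Im z > 0} \<subset> {z. Im z > 0}" using B_quadrant(2) by blast
  then show "norm (deriv B x0) < 1"
    using upper_half_plane_Schwarz_Pick_strict[OF B_holo] x0_quadrant B_fixed by blast
qed

lemma Phi_lower_holo_inj: "Phi holomorphic_on {z. Im z < 0}" "inj_on Phi {z. Im z < 0}"
  by (rule holomorphic_on_subset[OF Phi_holo] inj_on_subset[OF Phi_inj], force)+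

lemma E_open: "open E"
  unfolding E_def using open_mapping_thm3[OF Phi_lower_holo_inj(1) open_halfspace_Im_lt Phi_lower_holo_inj(2)] .

lemma x0_closure_E: "x0 \<in> closure E"
proof -
  obtain a where a: "filterlim a at_infinity sequentially" "\<And>n. Im (a n) < 0" using lower_seq by metis
  then show ?thesis unfolding closure_sequential
    using Phi_seq[OF a] by (intro exI[of _ "\<lambda>n. Phi (a n)"]) (auto simp: E_def)
qed

lemma B_E: "B ` (E \<inter> {z. Im z > 0}) \<subseteq> E"
proof -
  have "B (Phi \<zeta>) \<in> E" if "Im \<zeta> < 0" for \<zeta>
    unfolding B_Phi[OF that] E_def using that lam
    by (intro imageI) (simp add: divide_neg_pos flip: of_real_power)
  then show ?thesis by (auto simp: E_def)
qed

lemma E_not_deep: "not_deep_at (- E) x0"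
  using attracting_fixed_point_not_deep[OF B_holo open_halfspace_Im_gt _ B_fixed B_multiplier
      E_open x0_closure_E B_E] x0_quadrant by simp

section \<open>The set \<open>E\<close> and the maximal domain\<close>

text \<open>\<open>G 1 = G (f 0) = 0\<close>, so \<open>Phi\<close> is small just below 1. Thus
  \<open>E\<close> reaches the region where \<open>f\<close> is given.\<close>

lemma E_near_0:
  assumes "0 < e"
  obtains z where "z \<in> E" "norm z < e"
proof -
  have "1 \<in> slit_plane lam" using of_real_in_slit_plane[of lam 1] lam by simp
  then have "isCont G 1"
    using G_holo open_slit_plane continuous_on_eq_continuous_at holomorphic_on_imp_continuous_on by blast
  moreover have "G 1 = 0" using G_f_real[of 0] f_U(4) l by simp
  moreover have "0 < e ^ l" using assms by simp
  ultimately obtain d where d: "0 < d" "\<And>z. dist z 1 < d \<Longrightarrow> norm (G z) < e ^ l"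
    unfolding continuous_at_eps_delta by (metis dist_0_norm dist_commute dist_norm)
  define \<zeta> where "\<zeta> = 1 - \<i> * of_real (d / 2)"
  have \<zeta>: "Im \<zeta> < 0" "dist \<zeta> 1 < d" using d by (auto simp: \<zeta>_def dist_norm norm_mult)
  then have "norm (Phi \<zeta>) ^ l < e ^ l" using d(2) Phi_power[of \<zeta>] by (metis less_irrefl norm_power)
  then have "norm (Phi \<zeta>) < e" using assms power_less_imp_less_base by (metis less_imp_le)
  then show thesis using that \<zeta> by (auto simp: E_def)
qed

text \<open>The extension is the inverse of \<open>Phi\<close>: if \<open>z = Phi \<zeta>\<close>
  lies where \<open>G (f z) = z ^ l\<close>, then \<open>G (f z) = G \<zeta>\<close>, and
  injectivity gives \<open>f z = \<zeta>\<close>.\<close>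

lemma E_analytic_extension:
  obtains g where "analytic_extension U f E g" "\<And>\<zeta>. Im \<zeta> < 0 \<Longrightarrow> g (Phi \<zeta>) = \<zeta>"
proof -
  obtain g where g: "g holomorphic_on E" "\<And>\<zeta>. Im \<zeta> < 0 \<Longrightarrow> g (Phi \<zeta>) = \<zeta>"
    using holomorphic_has_inverse[OF Phi_lower_holo_inj(1) open_halfspace_Im_lt Phi_lower_holo_inj(2)]
    unfolding E_def by (metis mem_Collect_eq)
  obtain S where S: "open S" "S \<subseteq> U" "complex_of_real ` {-1..1} \<subseteq> S"
    "\<And>z. z \<in> S \<Longrightarrow> f z \<in> slit_plane lam" "\<And>z. z \<in> S \<Longrightarrow> G (f z) = z ^ l"
    using G_f by metis
  have "0 \<in> S" using subsetD[OF S(3), of "of_real 0"] by auto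
  then obtain e where e: "0 < e" "ball 0 e \<subseteq> S" using S(1) openE by blast
  obtain z0 where "z0 \<in> E" "norm z0 < e" using E_near_0[OF e(1)] .
  then have "S \<inter> E \<noteq> {}" using e by auto
  moreover have "g z = f z" if z: "z \<in> S \<inter> E" for z
  proof -
    obtain \<zeta> where \<zeta>: "Im \<zeta> < 0" "z = Phi \<zeta>" using z by (auto simp: E_def)
    then have "G (f z) = G \<zeta>" using S(5)[of z] Phi_power[of \<zeta>] that by simp
    then have "f z = \<zeta>" using G_inj S(4)[of z] that \<zeta> nonreal_in_slit_plane[of \<zeta>] by (auto dest: inj_onD)
    then show ?thesis using g(2) \<zeta> by simp
  qed
  moreover have "connected E" unfolding E_def
    by (intro connected_continuous_image convex_connected[OF convex_halfspace_Im_lt]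
        holomorphic_on_imp_continuous_on Phi_lower_holo_inj)
  ultimately have "analytic_extension U f E g"
    unfolding analytic_extension_def using g(1) E_open S(1,2)
    by (intro conjI exI[of _ "S \<inter> E"]) auto
  then show thesis using that g(2) by blast
qed

text \<open>On \<open>E\<close> the maximal extension inverts \<open>Phi\<close>, so it is unbounded
  along \<open>Phi (a n)\<close>, which tends to \<open>x0\<close>; it cannot be continuous
  there.\<close>

lemma maximal_domain:
  assumes "maximal_analytic_extension U f What fhat"
  shows "E \<subseteq> What" "x0 \<notin> What"
proof -
  obtain g where g: "analytic_extension U f E g" "\<And>\<zeta>. Im \<zeta> < 0 \<Longrightarrow> g (Phi \<zeta>) = \<zeta>"
    using E_analytic_extension by metis
  then have E: "E \<subseteq> What" and eq: "\<And>z. z \<in> E \<Longrightarrow> g z = fhat z"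
    using assms by (auto simp: maximal_analytic_extension_def)
  show "E \<subseteq> What" by (rule E)
  show "x0 \<notin> What"
  proof
    assume "x0 \<in> What"
    have "open What" "fhat holomorphic_on What"
      using assms by (auto simp: maximal_analytic_extension_def analytic_extension_def)
    then have cont: "isCont fhat x0"
      using \<open>x0 \<in> What\<close> continuous_on_eq_continuous_at holomorphic_on_imp_continuous_on by blast
    obtain a where a: "filterlim a at_infinity sequentially" "\<And>n. Im (a n) < 0" using lower_seq by metis
    have "fhat (Phi (a n)) = a n" for n
      using eq[of "Phi (a n)"] g(2)[of "a n"] a(2)[of n] by (auto simp: E_def)
    moreover have "(\<lambda>n. fhat (Phi (a n))) \<longlonglongrightarrow> fhat x0"
      using isCont_tendsto_compose[OF cont Phi_seq[OF a]] .
    ultimately show False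
      using not_tendsto_and_filterlim_at_infinity[OF sequentially_bot _ a(1)] by simp
  qed
qed

end

section \<open>Identification of the boundary point\<close>

text \<open>Arguments in ]0,pi/l[ pass to the limit as [0,pi/l], which is within the range of the
  principal root.\<close>

lemma frontier_W_plus_proot:
  assumes l: "l \<ge> 2" and x: "x \<in> frontier (W_plus l lam G)" and Im: "Im (x ^ l) > 0"
  shows "proot l (x ^ l) = x"
proof -
  have "x \<noteq> 0" using Im l by (cases "x = 0") (auto simp: power_0_left)
  have "x \<in> closure (W_plus l lam G)" using x by (simp add: frontier_def)
  then obtain s where s: "\<And>n. s n \<in> W_plus l lam G" "s \<longlonglongrightarrow> x"
    unfolding closure_sequential by metis
  have Arg_s: "0 < Arg (s n)" "Arg (s n) < pi / l" for n
    using s(1)[of n] by (auto simp: W_plus_def)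
  have pil: "pi / l \<le> pi / 2" using l by (intro divide_left_mono) auto
  \<comment> \<open>This keeps the nonzero limit off the cut of \<open>Arg\<close>, where continuity
    would fail.\<close>
  have "0 \<le> Re (s n)" for n
  proof (intro Arg_Re_nonneg[THEN iffD1])
    show "\<bar>Arg (s n)\<bar> \<le> pi / 2" using Arg_s[of n] pil by linarith
  qed
  then have "0 \<le> Re x"
    by (intro LIMSEQ_le_const[OF tendsto_Re[OF s(2)]]) auto
  moreover have "Im x \<noteq> 0 \<or> Re x \<noteq> 0" using \<open>x \<noteq> 0\<close> by (auto simp: complex_eq_iff)
  ultimately have "x \<notin> \<real>\<^sub>\<le>\<^sub>0" by (auto simp: complex_nonpos_Reals_iff)
  then have "(\<lambda>n. Arg (s n)) \<longlonglongrightarrow> Arg x"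
    by (intro isCont_tendsto_compose[OF continuous_at_Arg s(2)])
  then have "0 \<le> Arg x" "Arg x \<le> pi / l"
    using Arg_s by (meson LIMSEQ_le_const LIMSEQ_le_const2 less_imp_le)+
  moreover from this have "of_nat l * Arg x \<le> pi" using l by (simp add: field_simps)
  ultimately show ?thesis
    using l \<open>x \<noteq> 0\<close> pi_gt_zero by (intro proot_eqI) (auto intro: less_le_trans[of _ 0])
qed

theorem proposition5:
  fixes l :: nat and lam :: real
    and U What :: "complex set" and f fhat G :: "complex \<Rightarrow> complex"
    and c x1 :: complex
  assumes "even l" and "l \<ge> 2"
    and "period_doubling_fixed_point lam U f"
    and "inverse_univalent l lam f G"
    and "maximal_analytic_extension U f What fhat"
    and "(G \<longlongrightarrow> c) (inf at_infinity (principal {z. Im z < 0}))" and "Im c > 0"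
    and "x1 \<in> frontier (W_plus l lam G)" and "x1 ^ l = c"
  shows "x1 \<in> - What \<and> not_deep_at (- What) x1"
proof -
  interpret feigenbaum l lam U f G c using assms by unfold_locales
  have "x1 = x0"
    using frontier_W_plus_proot[of l x1 lam G] assms by (simp add: x0_def)
  then show ?thesis
    using maximal_domain[OF assms(5)] not_deep_at_mono[OF E_not_deep] by auto
qed

end
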